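(* Let $n\ge3$ and $k\ge3$ be integers. For every $\lambda$ and all $\alpha,\beta$ with $\lambda=1+\cos\alpha=\frac23(1+\cos\beta)$ and $\sin\beta\ne0$, $$\det\big(\lambda I_{n+k}-\mathcal{L}(P_{n,k})\big)=\frac{1}{2^n3^k\sin\beta}\Big(g_k(\beta)\cos(n\alpha)-g_{k-1}(\beta)\cos((n-1)\alpha)\Big),$$ where $g_j(x)=2\sin((j+1)x)+\sin(jx)-\sin((j-1)x)$.
   Context: $P_{n,k}$ ($n,k\ge1$) is the weighted graph on vertices $x_1,\dots,x_{n+k}$ whose weighted adjacency matrix $W$ has $w_{ij}=1$ if $|i-j|=1$, $w_{ii}=1$ if $n+1\le i\le n+k$, and $0$ otherwise. Degrees $d_i=\sum_jw_{ij}$, $D=\mathrm{diag}(d_i)$, and the normalized Laplacian is $\mathcal{L}(P_{n,k})=I-D^{-1/2}WD^{-1/2}$ (entries $1-w_{ii}/d_i$ on the diagonal and $-w_{ij}/\sqrt{d_id_j}$ off the diagonal). *)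

theory Defs
  imports Complex_Main "Jordan_Normal_Form.Determinant"
begin

text \<open>
  A weighted graph on vertices \<open>x\<^sub>1, \<dots>, x\<^sub>N\<close> is represented by its weighted adjacency
  matrix.  Matrix indices start at 0, so row (and column) \<open>i\<close> belongs to \<open>x\<^sub>i\<^sub>+\<^sub>1\<close>.
\<close>

definition weighted_degree :: "real mat \<Rightarrow> nat \<Rightarrow> real" where
  "weighted_degree W i = (\<Sum>j<dim_col W. W $$ (i, j))"

definition inv_sqrt_degree_mat :: "real mat \<Rightarrow> real mat" where
  "inv_sqrt_degree_mat W =
     mat (dim_row W) (dim_row W) (\<lambda>(i, j). if i = j then 1 / sqrt (weighted_degree W i) else 0)"

definition normalized_laplacian :: "real mat \<Rightarrow> real mat" where
  "normalized_laplacian W =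
     1\<^sub>m (dim_row W) - inv_sqrt_degree_mat W * W * inv_sqrt_degree_mat W"

text \<open>
  The weights of \<open>P\<^sub>n\<^sub>,\<^sub>k\<close>, with vertices numbered from 1 to \<open>n + k\<close>: a path whose last \<open>k\<close>
  vertices carry a loop.
\<close>

definition P_weight :: "nat \<Rightarrow> nat \<Rightarrow> nat \<Rightarrow> nat \<Rightarrow> real" where
  "P_weight n k i j =
     (if \<bar>int i - int j\<bar> = 1 then 1
      else if i = j \<and> n + 1 \<le> i \<and> i \<le> n + k then 1
      else 0)"

definition P_mat :: "nat \<Rightarrow> nat \<Rightarrow> real mat" where
  "P_mat n k = mat (n + k) (n + k) (\<lambda>(i, j). P_weight n k (i + 1) (j + 1))"

definition g :: "nat \<Rightarrow> complex \<Rightarrow> complex" where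
  "g j x = 2 * sin ((of_nat j + 1) * x) + sin (of_nat j * x) - sin ((of_nat j - 1) * x)"

end

theory Submission
  imports Defs
begin

text \<open>
  The matrix is tridiagonal, so its leading principal minors satisfy a three-term recurrence.
  On the loop-free part this is the Chebyshev recurrence in \<open>\<alpha>\<close>, with solution
  \<open>cos (m \<alpha>) / 2\<^bsup>m - 1\<^esup>\<close>; on the looped part it is the Chebyshev recurrence in \<open>\<beta>\<close>, solved by a
  combination of \<open>sin ((j + 1) \<beta>) / 3\<^bsup>j\<^esup>\<close> and \<open>sin (j \<beta>) / 3\<^bsup>j\<^esup>\<close>.  The last vertex has degree 2
  instead of 3, and the corresponding last step of the recurrence turns these sines into \<open>g\<close>.
\<close>

section \<open>Determinants of tridiagonal matrices\<close>

lemma det_tridiagonal_rec: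
  fixes f :: "nat \<Rightarrow> nat \<Rightarrow> 'a :: comm_ring_1"
  assumes row: "\<And>j. j < m \<Longrightarrow> f (Suc m) j = 0"
    and col: "\<And>i. i < m \<Longrightarrow> f i (Suc m) = 0"
  shows "det (mat (Suc (Suc m)) (Suc (Suc m)) (\<lambda>(i, j). f i j)) =
    f (Suc m) (Suc m) * det (mat (Suc m) (Suc m) (\<lambda>(i, j). f i j))
    - f m (Suc m) * f (Suc m) m * det (mat m m (\<lambda>(i, j). f i j))"
proof -
  let ?A = "mat (Suc (Suc m)) (Suc (Suc m)) (\<lambda>(i, j). f i j)"
  let ?B = "mat_delete ?A (Suc m) m"
  have carrier: "?B \<in> carrier_mat (Suc m) (Suc m)"
    by (simp add: mat_delete_def)
  have minor: "mat_delete ?A (Suc m) (Suc m) = mat (Suc m) (Suc m) (\<lambda>(i, j). f i j)"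
    by (rule eq_matI) (auto simp: mat_delete_def)
  \<comment> \<open>Deleting column \<open>m\<close> moves the old last column into position
    \<open>m\<close> of \<open>?B\<close>, so removing it together with row \<open>m\<close> leaves
    the leading block of order \<open>m\<close>.\<close>
  have minor_minor: "mat_delete ?B m m = mat m m (\<lambda>(i, j). f i j)"
    by (rule eq_matI) (auto simp: mat_delete_def)
  have last_col: "?B $$ (i, m) = f i (Suc m)" if "i < Suc m" for i
    using that by (auto simp: mat_delete_def)
  have "det ?B = (\<Sum>i<Suc m. ?B $$ (i, m) * cofactor ?B i m)"
    by (rule laplace_expansion_column[OF carrier]) simp
  also have "\<dots> = f m (Suc m) * cofactor ?B m m"
    using last_col col by simp
  also have "\<dots> = f m (Suc m) * det (mat m m (\<lambda>(i, j). f i j))"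
    by (simp add: cofactor_def minor_minor)
  finally have det_B: "det ?B = f m (Suc m) * det (mat m m (\<lambda>(i, j). f i j))" .
  \<comment> \<open>By \<open>row\<close>, only the last two entries of the last row survive; the
    cofactor at \<open>(Suc m, m)\<close> carries the minus sign.\<close>
  have "det ?A = (\<Sum>j<Suc (Suc m). ?A $$ (Suc m, j) * cofactor ?A (Suc m) j)"
    by (rule laplace_expansion_row) auto
  also have "\<dots> = f (Suc m) m * cofactor ?A (Suc m) m
      + f (Suc m) (Suc m) * cofactor ?A (Suc m) (Suc m)"
    using row by simp
  finally show ?thesis
    by (simp add: cofactor_def minor det_B algebra_simps)
qed

section \<open>Degrees and characteristic matrix of the looped path\<close>

lemma dim_P_mat [simp]: "dim_row (P_mat n k) = n + k" "dim_col (P_mat n k) = n + k"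
  by (simp_all add: P_mat_def)

lemma weighted_degree_P_mat:
  assumes "i < n + k"
  shows "weighted_degree (P_mat n k) i =
    of_bool (0 < i) + of_bool (Suc i < n + k) + of_bool (n \<le> i)"
proof -
  \<comment> \<open>The three summands are the left neighbour, the right neighbour and the loop.
    Since \<open>i - 1\<close> is truncated to 0 at \<open>i = 0\<close>, the left one needs its own
    guard; the right one is cut off by the summation range.\<close>
  have "weighted_degree (P_mat n k) i = (\<Sum>j<n + k.
      (if j = i - 1 then of_bool (0 < i) else 0) + (if j = Suc i then 1 else 0)
      + (if j = i then of_bool (n \<le> i) else 0))"
    unfolding weighted_degree_def
  proof (intro sum.cong)
    fix j assume "j \<in> {..<n + k}"
    then show "P_mat n k $$ (i, j) =
        (if j = i - 1 then of_bool (0 < i) else 0) + (if j = Suc i then 1 else 0)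
        + (if j = i then of_bool (n \<le> i) else 0)"
      using assms by (auto simp: P_mat_def P_weight_def)
  qed simp
  also have "\<dots> = of_bool (0 < i) + of_bool (Suc i < n + k) + of_bool (n \<le> i)"
    using assms by (auto simp: sum.distrib)
  finally show ?thesis .
qed

lemma normalized_laplacian_eq_mat:
  assumes "W \<in> carrier_mat N N"
  shows "normalized_laplacian W = mat N N (\<lambda>(i, j). (if i = j then 1 else 0)
    - W $$ (i, j) / (sqrt (weighted_degree W i) * sqrt (weighted_degree W j)))"
proof -
  have D: "inv_sqrt_degree_mat W = mat_diag N (\<lambda>i. 1 / sqrt (weighted_degree W i))"
    using assms by (auto simp: inv_sqrt_degree_mat_def mat_diag_def intro!: eq_matI)
  have DW: "mat_diag N d * W = mat N N (\<lambda>(i, j). d i * W $$ (i, j))" for d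
    by (rule mat_diag_mult_left[OF assms])
  have DWD: "mat N N w * mat_diag N d = mat N N (\<lambda>(i, j). mat N N w $$ (i, j) * d j)" for w d
    by (rule mat_diag_mult_right) simp
  have "dim_row W = N"
    using assms by simp
  then show ?thesis
    unfolding normalized_laplacian_def D DW DWD by (intro eq_matI) simp_all
qed

text \<open>An entry function on all index pairs, rather than a matrix, lets the leading minors of
  every order be cut from the same data.\<close>

definition charmat_entry :: "nat \<Rightarrow> nat \<Rightarrow> complex \<Rightarrow> nat \<Rightarrow> nat \<Rightarrow> complex" where
  "charmat_entry n k lam i j = (if i = j then lam else 0)
    - complex_of_real ((if i = j then 1 else 0) - P_weight n k (i + 1) (j + 1)
        / (sqrt (weighted_degree (P_mat n k) i) * sqrt (weighted_degree (P_mat n k) j)))"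

definition leading_minor :: "nat \<Rightarrow> nat \<Rightarrow> complex \<Rightarrow> nat \<Rightarrow> complex" where
  "leading_minor n k lam m = det (mat m m (\<lambda>(i, j). charmat_entry n k lam i j))"

lemma charmat_eq_mat:
  "lam \<cdot>\<^sub>m 1\<^sub>m (n + k) - map_mat complex_of_real (normalized_laplacian (P_mat n k)) =
    mat (n + k) (n + k) (\<lambda>(i, j). charmat_entry n k lam i j)"
proof -
  have "P_mat n k \<in> carrier_mat (n + k) (n + k)"
    by (intro carrier_matI) simp_all
  note laplacian = normalized_laplacian_eq_mat[OF this]
  have "P_mat n k $$ (i, j) = P_weight n k (i + 1) (j + 1)" if "i < n + k" "j < n + k" for i j
    using that by (simp add: P_mat_def)
  then show ?thesis
    unfolding laplacian by (intro eq_matI) (simp_all add: charmat_entry_def)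
qed

lemma charmat_entry_diag:
  assumes "i < n + k"
  shows "charmat_entry n k lam i i =
    lam - 1 + of_bool (n \<le> i) / of_real (weighted_degree (P_mat n k) i)"
proof -
  \<comment> \<open>The product of the two equal square roots is an absolute value, which
    nonnegativity removes.\<close>
  have "weighted_degree (P_mat n k) i \<ge> 0"
    using weighted_degree_P_mat[OF assms] by simp
  then show ?thesis
    using assms by (auto simp: charmat_entry_def P_weight_def)
qed

text \<open>Only the product of the two symmetric off-diagonal entries enters the recurrence, so the
  square roots pair up and rational coefficients remain.\<close>

lemma leading_minor_rec:
  assumes "Suc m < n + k"
  shows "leading_minor n k lam (Suc (Suc m)) =
    charmat_entry n k lam (Suc m) (Suc m) * leading_minor n k lam (Suc m)
    - 1 / of_real (weighted_degree (P_mat n k) m * weighted_degree (P_mat n k) (Suc m))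
      * leading_minor n k lam m"
proof -
  have nonneg: "weighted_degree (P_mat n k) m \<ge> 0" "weighted_degree (P_mat n k) (Suc m) \<ge> 0"
    using weighted_degree_P_mat[of m n k] weighted_degree_P_mat[of "Suc m" n k] assms by simp_all
  have "charmat_entry n k lam m (Suc m) * charmat_entry n k lam (Suc m) m =
      of_real (1 / ((sqrt (weighted_degree (P_mat n k) m) * sqrt (weighted_degree (P_mat n k) m))
        * (sqrt (weighted_degree (P_mat n k) (Suc m)) * sqrt (weighted_degree (P_mat n k) (Suc m)))))"
    by (simp add: charmat_entry_def P_weight_def mult_ac del: real_sqrt_mult_self)
  also have "\<dots> = 1 / of_real (weighted_degree (P_mat n k) m * weighted_degree (P_mat n k) (Suc m))"
    using nonneg by (simp only: real_sqrt_mult_self abs_of_nonneg of_real_divide of_real_1)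
  finally have off_diag: "charmat_entry n k lam m (Suc m) * charmat_entry n k lam (Suc m) m = \<dots>" .
  show ?thesis
    unfolding leading_minor_def off_diag[symmetric]
    by (rule det_tridiagonal_rec) (auto simp: charmat_entry_def P_weight_def)
qed

lemma leading_minor_0 [simp]: "leading_minor n k lam 0 = 1"
  by (simp add: leading_minor_def)

lemma leading_minor_1 [simp]: "leading_minor n k lam (Suc 0) = charmat_entry n k lam 0 0"
  by (simp add: leading_minor_def det_single)

section \<open>Solving the recurrence along the path\<close>

lemma cos_Suc_Suc_mult:
  fixes x :: complex
  shows "cos (of_nat (Suc (Suc m)) * x) = 2 * cos x * cos (of_nat (Suc m) * x) - cos (of_nat m * x)"
proof -
  have "of_nat (Suc (Suc m)) * x = of_nat (Suc m) * x + x" "of_nat m * x = of_nat (Suc m) * x - x"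
    by (simp_all add: algebra_simps)
  then show ?thesis
    by (simp only: cos_add cos_diff) simp
qed

lemma sin_Suc_Suc_mult:
  fixes x :: complex
  shows "sin (of_nat (Suc (Suc m)) * x) = 2 * cos x * sin (of_nat (Suc m) * x) - sin (of_nat m * x)"
proof -
  have "of_nat (Suc (Suc m)) * x = of_nat (Suc m) * x + x" "of_nat m * x = of_nat (Suc m) * x - x"
    by (simp_all add: algebra_simps)
  then show ?thesis
    by (simp only: sin_add sin_diff) simp
qed

text \<open>The end vertex has degree 1 and the other loop-free ones degree 2, so the coefficient is
  1/2 in the first step and 1/4 afterwards. The formula starts at order 1: extended to order 0 it
  would give 2 instead of 1, which is why order 2 is a second base case.\<close>

lemma leading_minor_loop_free:
  assumes "0 < k" "lam = 1 + cos \<alpha>" "Suc m \<le> n"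
  shows "leading_minor n k lam (Suc m) = cos (of_nat (Suc m) * \<alpha>) / 2 ^ m"
  using assms(3)
proof (induction m rule: less_induct)
  case (less m)
  have diag: "charmat_entry n k lam i i = cos \<alpha>" if "i < n" for i
    using that assms(1,2) by (simp add: charmat_entry_diag)
  consider "m = 0" | "m = 1" | l where "m = Suc (Suc l)"
    by (metis One_nat_def not0_implies_Suc)
  then show ?case
  proof cases
    case 1
    then show ?thesis using diag[of 0] less.prems by simp
  next
    case 2
    have "leading_minor n k lam (Suc m) = cos \<alpha> * cos \<alpha> - 1 / 2"
      using leading_minor_rec[of 0 n k lam] diag[of 0] diag[of 1] less.prems assms(1) 2
      by (simp add: weighted_degree_P_mat)
    also have "\<dots> = cos (2 * \<alpha>) / 2"
      unfolding cos_double_cos power2_eq_square by (simp add: field_simps)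
    finally show ?thesis
      using 2 by simp
  next
    case 3
    have rec: "leading_minor n k lam (Suc m) =
        cos \<alpha> * leading_minor n k lam (Suc (Suc l)) - 1 / 4 * leading_minor n k lam (Suc l)"
      using leading_minor_rec[of "Suc l" n k lam] diag[of "Suc (Suc l)"] less.prems assms(1) 3
      by (simp add: weighted_degree_P_mat)
    have IH: "leading_minor n k lam (Suc (Suc l)) = cos (of_nat (Suc (Suc l)) * \<alpha>) / 2 ^ Suc l"
        "leading_minor n k lam (Suc l) = cos (of_nat (Suc l) * \<alpha>) / 2 ^ l"
      using less.IH[of "Suc l"] less.IH[of l] less.prems 3 by (simp_all del: of_nat_Suc)
    show ?thesis
      unfolding rec IH unfolding 3 cos_Suc_Suc_mult[of "Suc l"]
      by (simp add: field_simps del: of_nat_Suc)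
  qed
qed

text \<open>Away from the last vertex, which \<open>j < k\<close> excludes, looped vertices have
  degree 3. The diagonal entry is then \<open>lam - 1 + 1 / 3\<close>, and multiplying the minors by
  \<open>3 ^ j\<close> turns the recurrence into the Chebyshev one in \<beta>. Two loop-free
  vertices make the one before the first loop have degree 2.\<close>

lemma leading_minor_looped:
  assumes n: "n = Suc (Suc l)" and lam: "lam = 1 + cos \<alpha>" "lam = 2 / 3 * (1 + cos \<beta>)"
    and "sin \<beta> \<noteq> 0" "j < k"
  shows "leading_minor n k lam (n + j) = 2 / (2 ^ n * 3 ^ j * sin \<beta>) *
    (sin (of_nat (Suc j) * \<beta>) * cos (of_nat n * \<alpha>)
      - sin (of_nat j * \<beta>) * cos (of_nat (Suc l) * \<alpha>))"
  using assms(5)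
proof (induction j rule: less_induct)
  case (less j)
  have diag: "charmat_entry n k lam i i = 2 / 3 * cos \<beta>" if "n \<le> i" "Suc i < n + k" for i
    using that n by (simp add: charmat_entry_diag weighted_degree_P_mat lam(2) field_simps)
  have loop_free: "leading_minor n k lam (Suc l) = cos (of_nat (Suc l) * \<alpha>) / 2 ^ l"
      "leading_minor n k lam (Suc (Suc l)) = cos (of_nat n * \<alpha>) / 2 ^ Suc l"
    using leading_minor_loop_free[OF _ lam(1), of k l n]
      leading_minor_loop_free[OF _ lam(1), of k "Suc l" n] less.prems n by simp_all
  consider "j = 0" | "j = 1" | i where "j = Suc (Suc i)"
    by (metis One_nat_def not0_implies_Suc)
  then show ?case
  proof cases
    case 1
    then show ?thesis
      using loop_free(2) n \<open>sin \<beta> \<noteq> 0\<close> by simp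
  next
    case 2
    \<comment> \<open>At the junction degrees 2 and 3 meet, giving 1/6; between looped vertices of
      degree 3 it becomes 1/9.\<close>
    have rec: "leading_minor n k lam (n + 1) = 2 / 3 * cos \<beta> * (cos (of_nat n * \<alpha>) / 2 ^ Suc l)
        - 1 / 6 * (cos (of_nat (Suc l) * \<alpha>) / 2 ^ l)"
    proof -
      have "charmat_entry n k lam n n = 2 / 3 * cos \<beta>"
        using diag[of n] less.prems 2 by simp
      moreover have "leading_minor n k lam (n + 1) =
          charmat_entry n k lam n n * leading_minor n k lam (Suc (Suc l))
          - 1 / 6 * leading_minor n k lam (Suc l)"
        using leading_minor_rec[of "Suc l" n k lam] less.prems n 2
        by (simp add: weighted_degree_P_mat)
      ultimately show ?thesis
        by (simp only: loop_free)
    qed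
    have double: "sin (of_nat (Suc 1) * \<beta>) = 2 * sin \<beta> * cos \<beta>" "sin (of_nat 1 * \<beta>) = sin \<beta>"
      by (simp_all add: sin_double)
    have "(2 :: complex) ^ n = 4 * 2 ^ l"
      using n by simp
    then show ?thesis
      unfolding rec 2 double using \<open>sin \<beta> \<noteq> 0\<close> by (simp add: field_simps del: of_nat_Suc)
  next
    case 3
    have rec: "leading_minor n k lam (n + Suc (Suc i)) =
        2 / 3 * cos \<beta> * leading_minor n k lam (n + Suc i) - 1 / 9 * leading_minor n k lam (n + i)"
      using leading_minor_rec[of "n + i" n k lam] diag[of "n + Suc i"] less.prems n 3
      by (simp add: weighted_degree_P_mat)
    have less_j: "i < j" "i < k" "Suc i < j" "Suc i < k"
      using 3 less.prems by simp_all
    show ?thesis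
      unfolding 3 rec less.IH[OF less_j(1,2)] less.IH[OF less_j(3,4)]
        sin_Suc_Suc_mult[of "Suc i"] sin_Suc_Suc_mult[of i]
      using \<open>sin \<beta> \<noteq> 0\<close> by (simp add: field_simps del: of_nat_Suc)
  qed
qed

section \<open>The last vertex and the functions \<open>g\<close>\<close>

lemma g_Suc: "g (Suc m) x = (4 * cos x + 1) * sin (of_nat (Suc m) * x) - 3 * sin (of_nat m * x)"
proof -
  have "of_nat (Suc m) + 1 = (of_nat (Suc (Suc m)) :: complex)"
      "of_nat (Suc m) - 1 = (of_nat m :: complex)"
    by simp_all
  then show ?thesis
    unfolding g_def by (simp only: sin_Suc_Suc_mult) (simp add: ring_distribs del: of_nat_Suc)
qed

theorem theorem5:
  fixes n k :: nat and lam \<alpha> \<beta> :: complex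
  assumes "n \<ge> 3" and "k \<ge> 3"
    and "lam = 1 + cos \<alpha>"
    and "lam = 2 / 3 * (1 + cos \<beta>)"
    and "sin \<beta> \<noteq> 0"
  shows "det (lam \<cdot>\<^sub>m 1\<^sub>m (n + k) - map_mat complex_of_real (normalized_laplacian (P_mat n k))) =
    1 / (2 ^ n * 3 ^ k * sin \<beta>) *
      (g k \<beta> * cos (of_nat n * \<alpha>) - g (k - 1) \<beta> * cos ((of_nat n - 1) * \<alpha>))"
proof -
  obtain l where n: "n = Suc (Suc l)"
    using \<open>n \<ge> 3\<close> that[of "n - 2"] by simp
  obtain j where k: "k = Suc (Suc j)"
    using \<open>k \<ge> 3\<close> that[of "k - 2"] by simp
  \<comment> \<open>The last vertex has degree 2, so its loop contributes 1/2 instead of 1/3; the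
    difference is the 1/6.\<close>
  have diag: "charmat_entry n k lam (n + Suc j) (n + Suc j) = 2 / 3 * cos \<beta> + 1 / 6"
    using n k by (simp add: charmat_entry_diag weighted_degree_P_mat assms(4) field_simps)
  have "det (lam \<cdot>\<^sub>m 1\<^sub>m (n + k) - map_mat complex_of_real (normalized_laplacian (P_mat n k))) =
      leading_minor n k lam (n + k)"
    by (simp add: charmat_eq_mat leading_minor_def)
  also have "\<dots> = (2 / 3 * cos \<beta> + 1 / 6) * leading_minor n k lam (n + Suc j)
      - 1 / 6 * leading_minor n k lam (n + j)"
    using leading_minor_rec[of "n + j" n k lam] diag n k
    by (simp add: weighted_degree_P_mat)
  also have "\<dots> = 1 / (2 ^ n * 3 ^ k * sin \<beta>) *
      (g k \<beta> * cos (of_nat n * \<alpha>) - g (k - 1) \<beta> * cos (of_nat (Suc l) * \<alpha>))"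
  proof -
    have j: "j < k" "Suc j < k" and k_minus_1: "k - 1 = Suc j"
      using k by simp_all
    show ?thesis
      unfolding leading_minor_looped[OF n assms(3-5) j(1)] leading_minor_looped[OF n assms(3-5) j(2)]
        k_minus_1
      \<comment> \<open>With \<open>3 ^ k\<close> factored out, the last step multiplies the sines
        of the two preceding minors by \<open>4 * cos \<beta> + 1\<close> and \<open>- 3\<close>,
        exactly the coefficients in \<open>g_Suc\<close>.\<close>
      unfolding k g_Suc using \<open>sin \<beta> \<noteq> 0\<close> by (simp add: field_simps del: of_nat_Suc)
  qed
  also have "of_nat (Suc l) = (of_nat n - 1 :: complex)"
    by (simp add: n)
  finally show ?thesis .
qed

end
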